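(* Let $n$ be a non-negative integer and let $q,a,b,c$ be non-zero complex numbers, with $\sqrt a$ a fixed square root of $a$, such that no denominator on either side below vanishes. Then $${}_6\phi_5\left[\begin{matrix} a,\ q\sqrt a,\ -q\sqrt a,\ b,\ c,\ q^{-n}\\ \sqrt a,\ -\sqrt a,\ aq/b,\ aq/c,\ aq^{n+1}\end{matrix};q,\frac{aq^{n+1}}{bc}\right]=\frac{(aq,\ aq/(bc);q)_n}{(aq/b,\ aq/c;q)_n} .$$
   Context: For complex $a,q$ and a non-negative integer $n$, $(a;q)_n:=\prod_{k=0}^{n-1}(1-aq^k)$, with $(a;q)_0=1$, and $(a_1,\ldots,a_k;q)_n:=\prod_{i=1}^k (a_i;q)_n$. The unilateral basic hypergeometric series is $${}_{r+1}\phi_r\left[\begin{matrix} a_0,\ldots,a_r\\ b_1,\ldots,b_r\end{matrix};q,z\right]:=\sum_{j=0}^{\infty}\frac{(a_0,\ldots,a_r;q)_j}{(q,b_1,\ldots,b_r;q)_j}z^j .$$ When one numerator parameter is $q^{-n}$ the series terminates and is read as the finite sum over $0\le j\le n$ (so no convergence condition on $z$ is needed). *)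

theory Defs
  imports Complex_Main
begin

definition qpoch :: "complex \<Rightarrow> complex \<Rightarrow> nat \<Rightarrow> complex" where
  "qpoch a q n = (\<Prod>k<n. 1 - a * q ^ k)"

definition qpochs :: "complex list \<Rightarrow> complex \<Rightarrow> nat \<Rightarrow> complex" where
  "qpochs as q n = (\<Prod>a\<leftarrow>as. qpoch a q n)"

(* For a list of r + 1 numerator parameters and a list of r denominator parameters this is
   the series _(r+1) phi _r.  The extra denominator parameter q is inserted here. *)
definition basic_hypergeom :: "complex list \<Rightarrow> complex list \<Rightarrow> complex \<Rightarrow> complex \<Rightarrow> complex" where
  "basic_hypergeom as bs q z = (\<Sum>j. qpochs as q j / qpochs (q # bs) q j * z ^ j)"

(* If q^(-n) is a numerator parameter, all numerators with j > n are 0; since 0 / x = 0 for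
   every x (including x = 0), the infinite sum is the finite sum over j \<le> n, for every z and
   regardless of whether denominators with j > n vanish. *)
lemma basic_hypergeom_terminating:
  assumes "q \<noteq> 0" and "q powi (- int n) \<in> set as"
  shows "basic_hypergeom as bs q z = (\<Sum>j\<le>n. qpochs as q j / qpochs (q # bs) q j * z ^ j)"
proof -
  have "qpochs as q j = 0" if "j \<notin> {..n}" for j
  proof -
    have "1 - q powi (- int n) * q ^ n = 0"
      using assms(1) by (simp add: power_int_minus)
    moreover have "n \<in> {..<j}" using that by simp
    ultimately have "qpoch (q powi (- int n)) q j = 0"
      unfolding qpoch_def by (intro prod_zero) auto
    with assms(2) show ?thesis
      unfolding qpochs_def prod_list_zero_iff by force
  qed
  then show ?thesis
    unfolding basic_hypergeom_def by (intro suminf_finite) auto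
qed

end

theory Submission
  imports Defs
begin

text \<open>
  The factors with \<open>\<plusminus> q \<surd>a\<close> over \<open>\<plusminus> \<surd>a\<close> collapse to \<open>(1 - a q\<^sup>2\<^sup>j) / (1 - a)\<close>, so the square root
  disappears and the sum is \<open>S n\<close>, a finite sum of the terms \<open>vwp_term\<close>.  The product on the
  right-hand side satisfies a first-order recurrence in \<open>n\<close>; with \<open>p = q\<^sup>n\<^sup>+\<^sup>1\<close> it suffices that
  \<open>(1 - ap/b) (1 - ap/c) S (n + 1) = (1 - ap) (1 - ap/(bc)) S n\<close>.

  This recurrence is proved by creative telescoping (\<open>vwp_sum_recurrence\<close>): the corresponding
  combination of summands is a difference \<open>G (j + 1) - G j\<close> up to the factor \<open>1 - ap\<close>, and \<open>G\<close>
  vanishes at both ends of the range.  After division by a common factor, this is the rational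
  identity \<open>certificate_identity\<close> in \<open>x = q\<^sup>j\<close>.

  The induction on \<open>n\<close> passes through all smaller values of \<open>n\<close>, whose denominators involve other
  powers of \<open>q\<close>.  It therefore needs \<open>a q\<^sup>k \<noteq> 1\<close> for all \<open>k \<le> 2n\<close> (\<open>vwp_sum_generic\<close>), whereas the
  denominators at \<open>n\<close> itself allow \<open>a q\<^sup>k = 1\<close> for some \<open>k\<close> between \<open>1\<close> and \<open>n\<close>.  These
  exceptional \<open>a\<close> are isolated, and both sides are continuous in \<open>a\<close> where their denominators do
  not vanish, so the identity extends to them (\<open>vwp_sum\<close>).
\<close>

section \<open>Shifted factorials\<close>

lemma qpoch_0 [simp]: "qpoch a q 0 = 1"
  by (simp add: qpoch_def)

lemma qpoch_Suc: "qpoch a q (Suc n) = qpoch a q n * (1 - a * q ^ n)"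
  by (simp add: qpoch_def)

lemma qpoch_Suc_shift: "qpoch a q (Suc n) = (1 - a) * qpoch (a * q) q n"
  unfolding qpoch_def by (subst prod.lessThan_Suc_shift) (simp add: mult.assoc)

lemma qpoch_eq_0_iff: "qpoch a q n = 0 \<longleftrightarrow> (\<exists>k<n. a * q ^ k = 1)"
  by (auto simp: qpoch_def)

lemma isCont_qpoch [continuous_intros]:
  assumes "isCont f x"
  shows "isCont (\<lambda>y. qpoch (f y) q n) x"
  unfolding qpoch_def by (intro continuous_intros assms)

section \<open>The recurrence in \<open>n\<close> by creative telescoping\<close>

text \<open>
  The summand of the very-well-poised series.  The quotient \<open>(1 - a q\<^sup>2\<^sup>j) / (1 - a)\<close> replaces the
  four factorials with \<open>\<plusminus>\<surd>a\<close>, so that the summand is a rational function of \<open>a\<close>.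
\<close>

definition vwp_term :: "complex \<Rightarrow> complex \<Rightarrow> complex \<Rightarrow> complex \<Rightarrow> nat \<Rightarrow> nat \<Rightarrow> complex" where
  "vwp_term a b c q n j =
     (1 - a * q ^ (2 * j)) / (1 - a)
     * (qpoch a q j * qpoch b q j * qpoch c q j * qpoch (1 / q ^ n) q j)
     / (qpoch q q j * qpoch (a * q / b) q j * qpoch (a * q / c) q j * qpoch (a * q ^ (n + 1)) q j)
     * (a * q ^ (n + 1) / (b * c)) ^ j"

text \<open>
  The telescoping identity with the common factor of all terms removed; \<open>x\<close> stands for \<open>q\<^sup>j\<close>.
  The substitution \<open>x \<mapsto> 1/(ax)\<close> exchanges the two products on the right, up to the factor
  \<open>a\<^sup>2 x\<^sup>4\<close>.  So their difference vanishes where \<open>a x\<^sup>2 = 1\<close>, which explains the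
  very-well-poised factor \<open>1 - a x\<^sup>2\<close> on the left.
\<close>

lemma certificate_identity:
  fixes a b c p x :: complex
  assumes "b \<noteq> 0" "c \<noteq> 0" "p \<noteq> 0" "p \<noteq> 1"
  shows "(1 - a*p/b) * (1 - a*p/c) * ((1 - a*x^2) * x)
           - (1 - a*p/(b*c)) * ((1 - a*x^2) * ((p - x) / (p - 1)) * (1 - a*p*x))
         = p / (p - 1) * (a*p/(b*c) * ((1 - a*x) * (1 - b*x) * (1 - c*x) * (1 - x/p))
                          - (1 - x) * (1 - a*x/b) * (1 - a*x/c) * (1 - a*p*x))"
proof -
  \<comment> \<open>With the reciprocals of \<open>b\<close> and \<open>c\<close> as variables, only the denominator \<open>p - 1\<close> remains
      and the claim becomes a polynomial identity.\<close>
  define B C where "B = 1 / b" and "C = 1 / c"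
  have p1: "p - 1 \<noteq> 0" using assms by simp
  have d: "a*p/b = a*p*B" "a*p/c = a*p*C" "a*p/(b*c) = a*p*B*C" "a*x/b = a*x*B" "a*x/c = a*x*C"
    by (simp_all add: B_def C_def divide_inverse mult_ac)
  have f: "B * (1 - b*x) = B - x" "C * (1 - c*x) = C - x" "p * (1 - x/p) = p - x"
    using assms by (simp_all add: B_def C_def field_simps)
  have "a*p*B*C * ((1 - a*x) * (1 - b*x) * (1 - c*x) * (1 - x/p))
      = a * (1 - a*x) * (B * (1 - b*x)) * (C * (1 - c*x)) * (p * (1 - x/p))"
    by (simp only: mult_ac)
  then have e: "a*p*B*C * ((1 - a*x) * (1 - b*x) * (1 - c*x) * (1 - x/p))
      = a * (1 - a*x) * (B - x) * (C - x) * (p - x)"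
    unfolding f .
  have poly: "(p - 1) * ((1 - a*p*B) * (1 - a*p*C) * ((1 - a*x^2) * x))
           - (1 - a*p*B*C) * ((1 - a*x^2) * (p - x) * (1 - a*p*x))
         = p * (a * (1 - a*x) * (B - x) * (C - x) * (p - x)
                          - (1 - x) * (1 - a*x*B) * (1 - a*x*C) * (1 - a*p*x))"
    by (simp add: algebra_simps power2_eq_square)
  have clear: "X - Y * (Z * (R / K) * T) = p / K * W"
    if "K * X - Y * (Z * R * T) = p * W" "K \<noteq> 0" for X Y Z R T K W :: complex
    using that by (simp add: field_simps)
  show ?thesis unfolding d e by (rule clear [OF poly p1])
qed

text \<open>
  The sums at \<open>n\<close> and at \<open>n + 1\<close> are compared term by term.  The sum at \<open>n\<close> may be extended to
  \<open>j = n + 1\<close>, where its summand is \<open>0\<close>; the two summands then differ by simple rational factors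
  in \<open>q\<^sup>j\<close>.
\<close>

lemma vwp_sum_recurrence:
  fixes a b c q :: complex and n :: nat
  defines "p \<equiv> q ^ Suc n"
  assumes nz: "q \<noteq> 0" "b \<noteq> 0" "c \<noteq> 0"
    and q: "qpoch q q (Suc n) \<noteq> 0"
    and ab: "qpoch (a * q / b) q (Suc n) \<noteq> 0" and ac: "qpoch (a * q / c) q (Suc n) \<noteq> 0"
    and a: "\<And>k. k \<le> 2 * Suc n \<Longrightarrow> a * q ^ k \<noteq> 1"
  shows "(1 - a*p/b) * (1 - a*p/c) * (\<Sum>j\<le>Suc n. vwp_term a b c q (Suc n) j)
         = (1 - a*p) * (1 - a*p/(b*c)) * (\<Sum>j\<le>n. vwp_term a b c q n j)"
proof -
  \<comment> \<open>A common factor of the summands at \<open>n\<close> and \<open>n + 1\<close>: it combines the numerator \<open>(1/p)\<^sub>j\<close>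
      belonging to \<open>n + 1\<close> with the denominator \<open>(ap)\<^sub>j\<close> belonging to \<open>n\<close>, lengthened by one
      factor so that it also contains the \<open>(apq)\<^sub>j\<close> belonging to \<open>n + 1\<close>.\<close>
  define w where "w j = qpoch a q j * qpoch b q j * qpoch c q j * qpoch (1/p) q j
      / (qpoch q q j * qpoch (a*q/b) q j * qpoch (a*q/c) q j * qpoch (a*p) q (Suc j))
      * (a*p/(b*c)) ^ j / (1 - a)" for j
  define G where "G j = p / (p - 1) * (w j * ((1 - q^j) * (1 - a*q^j/b) * (1 - a*q^j/c) * (1 - a*p*q^j)))" for j
  have p0: "p \<noteq> 0" using nz by (simp add: p_def)
  have p1: "p \<noteq> 1" using q by (auto simp: qpoch_eq_0_iff p_def)
  have ap: "a * p \<noteq> 1" using a[of "Suc n"] by (simp add: p_def)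
  have apj: "qpoch (a*p) q (Suc j) \<noteq> 0" if "j \<le> Suc n" for j
  proof -
    have "a * p * q ^ k \<noteq> 1" if "k < Suc j" for k
      using a[of "Suc n + k"] that \<open>j \<le> Suc n\<close> by (simp add: p_def power_add mult.assoc)
    then show ?thesis by (auto simp: qpoch_eq_0_iff)
  qed
  have den: "qpoch q q j \<noteq> 0" "qpoch (a*q/b) q j \<noteq> 0" "qpoch (a*q/c) q j \<noteq> 0"
    if "j \<le> Suc n" for j
    using q ab ac that by (auto simp: qpoch_eq_0_iff)
  have tN: "vwp_term a b c q (Suc n) j = w j * (1 - a*p) * ((1 - a*(q^j)^2) * q^j)"
    if j: "j \<le> Suc n" for j
  proof -
    have s: "qpoch (a*p) q (Suc j) = (1 - a*p) * qpoch (a*p*q) q j" by (rule qpoch_Suc_shift)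
    have e: "a * q ^ (Suc n + 1) = a*p*q" "1 / q ^ Suc n = 1/p" "q ^ (2*j) = (q^j)^2"
      by (simp_all add: p_def power_mult [symmetric] mult_ac)
    have z: "(a*p*q/(b*c)) ^ j = (a*p/(b*c)) ^ j * q ^ j"
      by (simp add: power_mult_distrib power_divide)
    have gen: "Y / A * N / (Q*B*C*D) * (Z*x) = N / (Q*B*C*(e*D)) * Z / A * e * (Y*x)"
      if "e \<noteq> 0" for Y A N Q B C D Z x e :: complex
      using that by (simp add: mult_ac)
    show ?thesis
      unfolding vwp_term_def w_def e z s by (rule gen) (use ap in simp)
  qed
  have tn: "vwp_term a b c q n j = w j * ((1 - a*(q^j)^2) * ((p - q^j) / (p - 1)) * (1 - a*p*q^j))"
    if j: "j \<le> Suc n" for j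
  proof -
    have s: "qpoch (a*p) q (Suc j) = qpoch (a*p) q j * (1 - a*p*q^j)" by (rule qpoch_Suc)
    have e: "a * q ^ (n + 1) = a*p" "1 / q ^ n = 1/p*q" "q ^ (2*j) = (q^j)^2"
      using nz by (simp_all add: p_def power_mult [symmetric] mult_ac)
    have "qpoch (1/p) q j * (1 - 1/p*q^j) = (1 - 1/p) * qpoch (1/p*q) q j"
      by (metis qpoch_Suc qpoch_Suc_shift)
    then have r: "qpoch (1/p*q) q j = qpoch (1/p) q j * ((p - q^j) / (p - 1))"
      using p0 p1 by (simp add: field_simps)
    have gen: "Y / A * (N * (M * R)) / (Q*B*C*D) * Z = N * M / (Q*B*C*(D*e)) * Z / A * (Y*R*e)"
      if "e \<noteq> 0" for Y A N M R Q B C D Z e :: complex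
      using that by (simp add: mult_ac)
    show ?thesis
      unfolding vwp_term_def w_def e s r by (rule gen) (use apj[OF j] s in simp)
  qed
  \<comment> \<open>In \<open>G (j + 1)\<close> the last denominator factors of \<open>w (j + 1)\<close> cancel, which turns it into the
      other product of \<open>certificate_identity\<close>, multiplied by \<open>w j\<close>.\<close>
  have GSuc: "G (Suc j) = p / (p - 1) * (w j * (a*p/(b*c) * ((1 - a*q^j) * (1 - b*q^j) * (1 - c*q^j) * (1 - q^j/p))))"
    if j: "j \<le> Suc n" for j
  proof (cases "j = Suc n")
    case True
    \<comment> \<open>The denominator of \<open>w (n + 2)\<close> may vanish, so there is nothing to cancel; but both sides
        are \<open>0\<close> because the numerator has the factor \<open>1 - q\<^sup>n\<^sup>+\<^sup>1 / p = 0\<close>.\<close>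
    have "qpoch (1/p) q (Suc (Suc n)) = 0"
      using p0 by (auto simp: qpoch_eq_0_iff p_def intro!: exI[of _ "Suc n"])
    then show ?thesis using True p0 by (simp add: G_def w_def p_def)
  next
    case False
    then have j': "Suc j \<le> Suc n" using j by simp
    note d = den[OF j'] apj[OF j']
    have "w (Suc j) * ((1 - q^Suc j) * (1 - a*q^Suc j/b) * (1 - a*q^Suc j/c) * (1 - a*p*q^Suc j))
       = w j * (a*p/(b*c) * ((1 - a*q^j) * (1 - b*q^j) * (1 - c*q^j) * (1 - q^j/p)))"
    proof -
      have gen: "N * n1 * (N2 * n2) * (N3 * n3) * (N4 * n4) / (Q * q1 * (B * b1) * (C * c1) * (D * d1)) * (z * Z) / A
            * (q1 * b1 * c1 * d1)
          = N * N2 * N3 * N4 / (Q*B*C*D) * Z / A * (z * (n1 * n2 * n3 * n4))"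
        if "q1 \<noteq> 0" "b1 \<noteq> 0" "c1 \<noteq> 0" "d1 \<noteq> 0"
        for N n1 N2 n2 N3 n3 N4 n4 Q q1 B b1 C c1 D d1 z Z A :: complex
        using that by (simp add: mult_ac)
      have e: "qpoch q q (Suc j) = qpoch q q j * (1 - q^Suc j)"
        "qpoch (a*q/b) q (Suc j) = qpoch (a*q/b) q j * (1 - a*q^Suc j/b)"
        "qpoch (a*q/c) q (Suc j) = qpoch (a*q/c) q j * (1 - a*q^Suc j/c)"
        "qpoch (1/p) q (Suc j) = qpoch (1/p) q j * (1 - q^j/p)"
        "qpoch (a*p) q (Suc (Suc j)) = qpoch (a*p) q (Suc j) * (1 - a*p*q^Suc j)"
        by (simp_all add: qpoch_Suc mult_ac)
      show ?thesis
        unfolding w_def e qpoch_Suc[of a _ j] qpoch_Suc[of b _ j] qpoch_Suc[of c _ j]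
          power_Suc[of "a*p/(b*c)" j]
        by (rule gen) (use d in \<open>auto simp only: e mult_eq_0_iff de_Morgan_disj\<close>)
    qed
    then show ?thesis by (simp add: G_def)
  qed
  have step: "(1 - a*p/b) * (1 - a*p/c) * vwp_term a b c q (Suc n) j
        - (1 - a*p) * (1 - a*p/(b*c)) * vwp_term a b c q n j = (1 - a*p) * (G (Suc j) - G j)"
    if j: "j \<le> Suc n" for j
  proof -
    have gen1: "B * C * (W * e * X) - e * D * (W * Y) = W * e * (B * C * X - D * Y)"
      and gen2: "W * e * (K * (X - Y)) = e * (K * (W * X) - K * (W * Y))"
      for B C D K W X Y e :: complex
      by (simp_all add: algebra_simps)
    have "(1 - a*p/b) * (1 - a*p/c) * vwp_term a b c q (Suc n) j
        - (1 - a*p) * (1 - a*p/(b*c)) * vwp_term a b c q n j =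
      w j * (1 - a*p) * ((1 - a*p/b) * (1 - a*p/c) * ((1 - a*(q^j)^2) * q^j)
           - (1 - a*p/(b*c)) * ((1 - a*(q^j)^2) * ((p - q^j) / (p - 1)) * (1 - a*p*q^j)))"
      unfolding tN[OF j] tn[OF j] by (rule gen1)
    also have "\<dots> = (1 - a*p) * (G (Suc j) - G j)"
      unfolding certificate_identity[OF nz(2,3) p0 p1] GSuc[OF j]
      unfolding G_def by (rule gen2)
    finally show ?thesis .
  qed
  have "G 0 = 0" by (simp add: G_def)
  have "G (Suc (Suc n)) = 0" using GSuc[of "Suc n"] p0 by (simp add: p_def)
  have "(\<Sum>j\<le>Suc n. G (Suc j) - G j) = 0"
    using \<open>G 0 = 0\<close> \<open>G (Suc (Suc n)) = 0\<close> sum_telescope[of "\<lambda>j. - G j" "Suc n"] by simp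
  then have "(\<Sum>j\<le>Suc n. (1 - a*p/b) * (1 - a*p/c) * vwp_term a b c q (Suc n) j
        - (1 - a*p) * (1 - a*p/(b*c)) * vwp_term a b c q n j) = 0"
    using step by (simp add: sum_distrib_left [symmetric] del: sum.atMost_Suc)
  moreover have "(\<Sum>j\<le>Suc n. vwp_term a b c q n j) = (\<Sum>j\<le>n. vwp_term a b c q n j)"
    using tn[of "Suc n"] by (simp add: p_def)
  ultimately show ?thesis
    by (simp only: sum_subtractf sum_distrib_left [symmetric] right_minus_eq)
qed

section \<open>Summation of the very-well-poised series\<close>

text \<open>
  The range \<open>k \<le> 2 * n\<close> covers the denominators \<open>1 - a q\<^sup>k\<close> of the sums at \<open>n\<close> and at all smaller
  values, through which the induction passes.
\<close>

lemma vwp_sum_generic: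
  fixes a b c q :: complex and n :: nat
  assumes nz: "q \<noteq> 0" "b \<noteq> 0" "c \<noteq> 0"
    and "qpoch q q n \<noteq> 0" "qpoch (a * q / b) q n \<noteq> 0" "qpoch (a * q / c) q n \<noteq> 0"
    and "\<And>k. k \<le> 2 * n \<Longrightarrow> a * q ^ k \<noteq> 1"
  shows "(\<Sum>j\<le>n. vwp_term a b c q n j)
         = qpoch (a*q) q n * qpoch (a*q/(b*c)) q n / (qpoch (a*q/b) q n * qpoch (a*q/c) q n)"
  using assms(4-)
proof (induction n)
  case 0
  then have "a \<noteq> 1" using 0(4)[of 0] by simp
  then show ?case by (simp add: vwp_term_def)
next
  case (Suc n)
  define p where "p = q ^ Suc n"
  have IH: "(\<Sum>j\<le>n. vwp_term a b c q n j)
         = qpoch (a*q) q n * qpoch (a*q/(b*c)) q n / (qpoch (a*q/b) q n * qpoch (a*q/c) q n)"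
    using Suc.prems by (intro Suc.IH) (auto simp: qpoch_Suc)
  have rec: "(1 - a*p/b) * (1 - a*p/c) * (\<Sum>j\<le>Suc n. vwp_term a b c q (Suc n) j)
         = (1 - a*p) * (1 - a*p/(b*c)) * (\<Sum>j\<le>n. vwp_term a b c q n j)"
    unfolding p_def by (rule vwp_sum_recurrence[OF nz Suc.prems])
  have S: "qpoch (a*q/d) q (Suc n) = qpoch (a*q/d) q n * (1 - a*p/d)"
    "qpoch (a*q) q (Suc n) = qpoch (a*q) q n * (1 - a*p)" for d
    by (simp_all add: qpoch_Suc p_def mult_ac)
  have nz': "1 - a*p/b \<noteq> 0" "1 - a*p/c \<noteq> 0"
    using Suc.prems(2,3) unfolding S by auto
  have "(\<Sum>j\<le>Suc n. vwp_term a b c q (Suc n) j)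
     = (1 - a*p) * (1 - a*p/(b*c)) * (\<Sum>j\<le>n. vwp_term a b c q n j) / ((1 - a*p/b) * (1 - a*p/c))"
    unfolding rec [symmetric] using nz' by (metis (no_types) mult_eq_0_iff nonzero_mult_div_cancel_left)
  moreover have "e * f * (A * B / (C * D)) / (g * h) = A * e * (B * f) / (C * g * (D * h))"
    for e f g h A B C D :: complex by (simp add: mult_ac)
  ultimately show ?case unfolding IH S by (rule trans)
qed

text \<open>
  Only the denominators at \<open>n\<close> itself are now required to be non-zero.  If \<open>a q\<^sup>k = 1\<close> with
  \<open>1 < k \<le> n\<close>, the recurrence breaks down, since the sum at \<open>k - 1\<close> has a vanishing denominator.
  But all \<open>x \<noteq> a\<close> close to \<open>a\<close> are generic, so the difference of the two sides is a function
  of \<open>x\<close> that is continuous at \<open>a\<close> and zero on a punctured neighbourhood of \<open>a\<close>.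
\<close>

lemma vwp_sum:
  fixes a b c q :: complex and n :: nat
  assumes nz: "q \<noteq> 0" "b \<noteq> 0" "c \<noteq> 0"
    and q: "qpoch q q n \<noteq> 0"
    and ab: "qpoch (a * q / b) q n \<noteq> 0" and ac: "qpoch (a * q / c) q n \<noteq> 0"
    and an: "qpoch (a * q ^ (n + 1)) q n \<noteq> 0" and a1: "a \<noteq> 1"
  shows "(\<Sum>j\<le>n. vwp_term a b c q n j)
         = qpoch (a*q) q n * qpoch (a*q/(b*c)) q n / (qpoch (a*q/b) q n * qpoch (a*q/c) q n)"
proof -
  define D where "D x = (\<Sum>j\<le>n. vwp_term x b c q n j)
     - qpoch (x*q) q n * qpoch (x*q/(b*c)) q n / (qpoch (x*q/b) q n * qpoch (x*q/c) q n)" for x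
  have le: "qpoch y q j \<noteq> 0" if "qpoch y q n \<noteq> 0" "j \<le> n" for y j
    using that by (auto simp: qpoch_eq_0_iff)
  have contD: "isCont D a"
    unfolding D_def vwp_term_def
    using ab ac a1 nz le[OF q] le[OF ab] le[OF ac] le[OF an]
    by (intro continuous_intros) (auto simp del: power_Suc power_add)
  have cont: "isCont (\<lambda>x. qpoch (x*q/b) q n) a" "isCont (\<lambda>x. qpoch (x*q/c) q n) a"
    using nz by (auto intro!: continuous_intros)
  have ev: "\<forall>\<^sub>F x in at a. f x \<noteq> 0" if "isCont f a" "f a \<noteq> 0" for f :: "complex \<Rightarrow> complex"
    using that by (auto simp: isCont_def intro: tendsto_imp_eventually_ne)
  have evk: "\<forall>\<^sub>F x in at a. x * q ^ k \<noteq> 1" for k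
  proof -
    have "\<forall>\<^sub>F x in at a. x \<noteq> 1 / q ^ k"
      by (rule eventually_neq_at_within)
    then show ?thesis by eventually_elim (use nz in \<open>simp add: field_simps\<close>)
  qed
  have evall: "\<forall>\<^sub>F x in at a. \<forall>k\<in>{..2*n}. x * q ^ k \<noteq> 1"
    by (rule eventually_ball_finite) (use evk in auto)
  have "\<forall>\<^sub>F x in at a. D x = 0"
    using ev[OF cont(1) ab] ev[OF cont(2) ac] evall
  proof eventually_elim
    case (elim x)
    then show ?case unfolding D_def using vwp_sum_generic[OF nz q, of x] by simp
  qed
  then have "(D \<longlongrightarrow> 0) (at a)" by (rule tendsto_eventually)
  with contD have "D a = 0"
    unfolding isCont_def by (intro LIM_unique)
  then show ?thesis by (simp add: D_def)
qed

section \<open>The terminating \<open>\<^sub>6\<phi>\<^sub>5\<close> series\<close>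

theorem theorem1p7:
  fixes n :: nat and q a b c sqrt_a :: complex
  assumes "q \<noteq> 0" and "a \<noteq> 0" and "b \<noteq> 0" and "c \<noteq> 0"
    and "sqrt_a ^ 2 = a"
    and "\<And>j. j \<le> n \<Longrightarrow>
           qpochs [q, sqrt_a, - sqrt_a, a * q / b, a * q / c, a * q ^ (n + 1)] q j \<noteq> 0"
    and "qpochs [a * q / b, a * q / c] q n \<noteq> 0"
  shows "basic_hypergeom
           [a, q * sqrt_a, - q * sqrt_a, b, c, q powi (- int n)]
           [sqrt_a, - sqrt_a, a * q / b, a * q / c, a * q ^ (n + 1)]
           q (a * q ^ (n + 1) / (b * c))
         = qpochs [a * q, a * q / (b * c)] q n / qpochs [a * q / b, a * q / c] q n"
proof (cases "n = 0")
  \<comment> \<open>For \<open>n = 0\<close> the hypotheses allow \<open>a = 1\<close>, where \<open>vwp_term\<close> has the denominator \<open>1 - a = 0\<close>.\<close>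
  case True
  then show ?thesis
    using assms(1) by (subst basic_hypergeom_terminating[where n = n]) (auto simp: qpochs_def)
next
  case False
  have nz: "qpoch q q j \<noteq> 0" "qpoch sqrt_a q j \<noteq> 0" "qpoch (- sqrt_a) q j \<noteq> 0"
    "qpoch (a * q / b) q j \<noteq> 0" "qpoch (a * q / c) q j \<noteq> 0" "qpoch (a * q ^ (n + 1)) q j \<noteq> 0"
    if "j \<le> n" for j
    using assms(6)[OF that] by (auto simp: qpochs_def simp del: power_Suc)
  have pm: "1 - sqrt_a \<noteq> 0" "1 + sqrt_a \<noteq> 0"
    using nz(2,3)[of 1] False by (auto simp: qpoch_def)
  have fact: "1 - a * y ^ 2 = (1 - sqrt_a * y) * (1 + sqrt_a * y)" for y
    unfolding assms(5) [symmetric] by algebra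
  have a1: "a \<noteq> 1" using fact[of 1] pm by auto
  have pw: "q powi (- int n) = 1 / q ^ n"
    by (simp add: power_int_minus divide_inverse)
  have summand: "qpochs [a, q * sqrt_a, - q * sqrt_a, b, c, q powi (- int n)] q j
      / qpochs [q, sqrt_a, - sqrt_a, a * q / b, a * q / c, a * q ^ (n + 1)] q j
      * (a * q ^ (n + 1) / (b * c)) ^ j = vwp_term a b c q n j" if j: "j \<le> n" for j
  proof -
    have shift: "(1 - s) * qpoch (q * s) q j = qpoch s q j * (1 - s * q ^ j)" for s
      by (metis qpoch_Suc qpoch_Suc_shift mult.commute)
    have 1: "qpoch (q * sqrt_a) q j = qpoch sqrt_a q j * (1 - sqrt_a * q ^ j) / (1 - sqrt_a)"
      using shift[of sqrt_a] pm by (simp add: field_simps)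
    have 2: "qpoch (- q * sqrt_a) q j = qpoch (- sqrt_a) q j * (1 + sqrt_a * q ^ j) / (1 + sqrt_a)"
      using shift[of "- sqrt_a"] pm by (simp add: field_simps)
    have 3: "(1 - a * q ^ (2 * j)) / (1 - a)
        = (1 - sqrt_a * q ^ j) * (1 + sqrt_a * q ^ j) / ((1 - sqrt_a) * (1 + sqrt_a))"
      using fact[of "q ^ j"] fact[of 1] by (simp add: power_mult [symmetric] mult.commute)
    show ?thesis
      unfolding vwp_term_def 3 pw qpochs_def list.map prod_list.Cons prod_list.Nil 1 2
      using nz(2,3)[OF j] by (simp del: power_Suc add: mult_ac)
  qed
  have "basic_hypergeom
           [a, q * sqrt_a, - q * sqrt_a, b, c, q powi (- int n)]
           [sqrt_a, - sqrt_a, a * q / b, a * q / c, a * q ^ (n + 1)]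
           q (a * q ^ (n + 1) / (b * c)) = (\<Sum>j\<le>n. vwp_term a b c q n j)"
    using assms(1) summand by (subst basic_hypergeom_terminating[where n = n]) (auto intro!: sum.cong)
  also have "\<dots> = qpochs [a * q, a * q / (b * c)] q n / qpochs [a * q / b, a * q / c] q n"
    using vwp_sum[OF assms(1,3,4) nz(1,4,5,6)[OF order_refl] a1] by (simp add: qpochs_def)
  finally show ?thesis .
qed

end
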